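(* Let $\mathcal{I}$ be an ideal on $X$. Then $\mathcal{I}$ is a minimal ideal if and only if $Ann(\mathcal{I})$ is a maximal ideal on $X$.
   Context: $X$ is a non-empty set and $2^X$ is its power set. An ideal on $X$ is a non-empty family $\mathcal{I}\subseteq 2^X$ such that (i) $A\in\mathcal{I}$ and $B\subseteq A$ imply $B\in\mathcal{I}$, and (ii) $A\in\mathcal{I}$ and $B\in\mathcal{I}$ imply $A\cup B\in\mathcal{I}$. An ideal $\mathcal{I}$ is proper if $\mathcal{I}\neq 2^X$. A proper ideal $\mathcal{I}$ on $X$ is said to be a maximal ideal if for any ideal $\mathcal{J}$ on $X$ with $\mathcal{I}\subseteq\mathcal{J}$, one has $\mathcal{I}=\mathcal{J}$ or $\mathcal{J}=2^X$. A proper ideal $\mathcal{I}$ on $X$ with $\mathcal{I}\neq\{\emptyset\}$ is said to be a minimal ideal if for any ideal $\mathcal{J}$ on $X$ with $\mathcal{J}\subseteq\mathcal{I}$, one has $\mathcal{I}=\mathcal{J}$ or $\mathcal{J}=\{\emptyset\}$. For $\mathcal{J}\subseteq 2^X$, the annihilator of $\mathcal{J}$ is $Ann(\mathcal{J})=\{A\subseteq X\mid (\forall J\in\mathcal{J})(A\cap J=\emptyset)\}$; it is an ideal on $X$.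
   Formalization: The case where X is a one-point set and the ideal is the whole power set of X is excluded: there the ideal is not proper, hence not minimal, although its annihilator {∅} is a maximal ideal, so the printed equivalence fails. *)

theory Defs
  imports Main
begin

definition set_ideal :: "'a set \<Rightarrow> 'a set set \<Rightarrow> bool" where
  "set_ideal X I \<longleftrightarrow>
     I \<subseteq> Pow X \<and> I \<noteq> {} \<and>
     (\<forall>A B. A \<in> I \<and> B \<subseteq> A \<longrightarrow> B \<in> I) \<and>
     (\<forall>A B. A \<in> I \<and> B \<in> I \<longrightarrow> A \<union> B \<in> I)"

definition proper_set_ideal :: "'a set \<Rightarrow> 'a set set \<Rightarrow> bool" where
  "proper_set_ideal X I \<longleftrightarrow> set_ideal X I \<and> I \<noteq> Pow X"

definition maximal_set_ideal :: "'a set \<Rightarrow> 'a set set \<Rightarrow> bool" where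
  "maximal_set_ideal X I \<longleftrightarrow>
     proper_set_ideal X I \<and>
     (\<forall>J. set_ideal X J \<and> I \<subseteq> J \<longrightarrow> I = J \<or> J = Pow X)"

definition minimal_set_ideal :: "'a set \<Rightarrow> 'a set set \<Rightarrow> bool" where
  "minimal_set_ideal X I \<longleftrightarrow>
     proper_set_ideal X I \<and> I \<noteq> {{}} \<and>
     (\<forall>J. set_ideal X J \<and> J \<subseteq> I \<longrightarrow> I = J \<or> J = {{}})"

definition Ann :: "'a set \<Rightarrow> 'a set set \<Rightarrow> 'a set set" where
  "Ann X F = {A. A \<subseteq> X \<and> (\<forall>J\<in>F. A \<inter> J = {})}"

text \<open>
  Minimal ideals are required to be proper. Hence on a one-point set the improper ideal is not
  minimal, although its annihilator is a maximal ideal: the equivalence between minimality of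
  an ideal and maximality of its annihilator fails for this ideal, and it has to be excluded.
\<close>

lemma singleton_counterexample:
  "set_ideal {x} (Pow {x})"
  "\<not> minimal_set_ideal {x} (Pow {x})"
  "maximal_set_ideal {x} (Ann {x} (Pow {x}))"
proof -
  show "set_ideal {x} (Pow {x})"
    by (auto simp: set_ideal_def)
  show "\<not> minimal_set_ideal {x} (Pow {x})"
    by (simp add: minimal_set_ideal_def proper_set_ideal_def)
  have ann: "Ann {x} (Pow {x}) = {{}}"
    by (auto simp: Ann_def)
  have "J = {{}} \<or> J = Pow {x}" if "set_ideal {x} J" for J
  proof -
    have "J \<subseteq> {{}, {x}}" "{} \<in> J"
      using that unfolding set_ideal_def by (auto simp: Pow_insert)
    then show ?thesis by (auto simp: Pow_insert)
  qed
  moreover have "set_ideal {x} {{}}"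
    by (auto simp: set_ideal_def)
  moreover have "{{}} \<noteq> Pow {x}"
    by (auto simp: Pow_insert)
  ultimately show "maximal_set_ideal {x} (Ann {x} (Pow {x}))"
    unfolding ann maximal_set_ideal_def proper_set_ideal_def by blast
qed

end

theory Submission
  imports Defs
begin

text \<open>
  Both sides of the equivalence say that the ideal is the power set of a single point \<open>x\<close>.

  An ideal other than \<open>{{}}\<close> contains a singleton \<open>{x}\<close>, hence the ideal \<open>Pow {x}\<close>; so a minimal
  ideal must equal \<open>Pow {x}\<close>, and conversely nothing but \<open>{{}}\<close> lies strictly below \<open>Pow {x}\<close>
  (\<open>minimal_iff_Pow_singleton\<close>). On the other side, the annihilator of \<open>I\<close> sees only the union of
  \<open>I\<close>: it is the principal ideal \<open>Pow (X - \<Union>I)\<close>. A principal ideal is maximal exactly when its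
  generator misses one point of \<open>X\<close> (\<open>maximal_Pow_iff\<close>), so \<open>Ann X I\<close> is maximal exactly when
  \<open>\<Union>I\<close> is a singleton. For an ideal this means again that \<open>I = Pow {x}\<close>, because an ideal whose
  union is \<open>{x}\<close> has a member containing \<open>x\<close>.

  The only difference between the two sides is that a minimal ideal has to be proper, that is
  \<open>X \<noteq> {x}\<close>; this is where the exclusion of the improper ideal on a one-point set enters.
\<close>

lemma set_ideal_Pow: "Y \<subseteq> X \<Longrightarrow> set_ideal X (Pow Y)"
  unfolding set_ideal_def by blast

lemma set_ideal_empty_mem: "set_ideal X I \<Longrightarrow> {} \<in> I"
  unfolding set_ideal_def by blast

lemma set_ideal_Pow_subset: "set_ideal X I \<Longrightarrow> A \<in> I \<Longrightarrow> Pow A \<subseteq> I"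
  unfolding set_ideal_def by blast

lemma set_ideal_trivial_iff: "set_ideal X I \<Longrightarrow> I = {{}} \<longleftrightarrow> \<Union>I = {}"
  using set_ideal_empty_mem by fastforce

text \<open>
  An ideal need not contain its union: the finite subsets of an infinite set do not. When the
  union is a single point, a member containing that point is already the whole union.
\<close>

lemma set_ideal_Union_singleton_iff:
  assumes "set_ideal X I"
  shows "\<Union>I = {x} \<longleftrightarrow> I = Pow {x}"
proof
  assume U: "\<Union>I = {x}"
  then obtain A where "A \<in> I" "x \<in> A" by blast
  then have "{x} \<in> I" using U by (metis Union_upper empty_iff subset_singletonD)
  then show "I = Pow {x}"
    using U set_ideal_Pow_subset[OF assms] by blast
qed simp

lemma minimal_iff_Pow_singleton:
  "minimal_set_ideal X I \<longleftrightarrow> proper_set_ideal X I \<and> (\<exists>x. I = Pow {x})"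
proof
  assume min: "minimal_set_ideal X I"
  then have proper: "proper_set_ideal X I" and id: "set_ideal X I" and "I \<noteq> {{}}"
    unfolding minimal_set_ideal_def proper_set_ideal_def by auto
  then obtain A x where A: "A \<in> I" "x \<in> A"
    using set_ideal_trivial_iff[OF id] by blast
  then have "Pow {x} \<subseteq> I" using set_ideal_Pow_subset[OF id] by blast
  moreover have "set_ideal X (Pow {x})"
    using A id by (intro set_ideal_Pow) (auto simp: set_ideal_def)
  ultimately have "I = Pow {x}"
    using min unfolding minimal_set_ideal_def by blast
  with proper show "proper_set_ideal X I \<and> (\<exists>x. I = Pow {x})" by blast
next
  assume "proper_set_ideal X I \<and> (\<exists>x. I = Pow {x})"
  then obtain x where proper: "proper_set_ideal X I" and I: "I = Pow {x}" by blast
  have "I = J \<or> J = {{}}" if J: "set_ideal X J" "J \<subseteq> I" for J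
  proof -
    have "\<Union>J \<subseteq> {x}" using J(2) I by blast
    then consider "\<Union>J = {}" | "\<Union>J = {x}" by blast
    then show ?thesis
      using set_ideal_trivial_iff[OF J(1)] set_ideal_Union_singleton_iff[OF J(1)] I by cases blast+
  qed
  then show "minimal_set_ideal X I"
    using proper I unfolding minimal_set_ideal_def by blast
qed

lemma Ann_eq_Pow: "Ann X F = Pow (X - \<Union>F)"
  unfolding Ann_def by blast

text \<open>
  An ideal strictly above \<open>Pow Y\<close> contains some \<open>{x}\<close> with \<open>x \<notin> Y\<close>, hence also \<open>insert x Y\<close>.
  So the ideals \<open>Pow (insert x Y)\<close> are the minimal ones among those strictly above \<open>Pow Y\<close>, and
  maximality asks that each of them be \<open>Pow X\<close>.
\<close>

lemma maximal_Pow_iff: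
  assumes "Y \<subseteq> X"
  shows "maximal_set_ideal X (Pow Y) \<longleftrightarrow> (\<exists>x. X - Y = {x})"
proof
  assume max: "maximal_set_ideal X (Pow Y)"
  then have "Y \<noteq> X" unfolding maximal_set_ideal_def proper_set_ideal_def by blast
  then obtain x where x: "x \<in> X" "x \<notin> Y" using assms by blast
  then have "set_ideal X (Pow (insert x Y))"
    using assms by (intro set_ideal_Pow) blast
  then have "Pow Y = Pow (insert x Y) \<or> Pow (insert x Y) = Pow X"
    using max unfolding maximal_set_ideal_def by blast
  then have "X = insert x Y" using x by blast
  then show "\<exists>x. X - Y = {x}" using x by blast
next
  assume "\<exists>x. X - Y = {x}"
  then obtain x where x: "X - Y = {x}" by blast
  then have X: "X = insert x Y" and "x \<notin> Y" using assms by auto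
  have "Pow Y = J \<or> J = Pow X" if J: "set_ideal X J" "Pow Y \<subseteq> J" for J
  proof (cases "\<Union>J \<subseteq> Y")
    case True
    then have "J \<subseteq> Pow Y" by (simp add: subset_Pow_Union Sup_le_iff subsetI)
    then show ?thesis using J(2) by simp
  next
    case False
    have sub: "J \<subseteq> Pow X" using J(1) by (simp add: set_ideal_def)
    obtain A z where A: "A \<in> J" "z \<in> A" "z \<notin> Y" using False by blast
    have "A \<subseteq> X" using A(1) sub by blast
    then have "A \<union> Y = X" using A(2,3) X by auto
    moreover have "A \<union> Y \<in> J" using A(1) J by (auto simp: set_ideal_def)
    ultimately have "Pow X \<subseteq> J" using set_ideal_Pow_subset[OF J(1)] by simp
    then show ?thesis using sub by simp
  qed
  moreover have "Pow Y \<noteq> Pow X" using X \<open>x \<notin> Y\<close> by blast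
  ultimately show "maximal_set_ideal X (Pow Y)"
    using set_ideal_Pow[OF assms]
    unfolding maximal_set_ideal_def proper_set_ideal_def by simp
qed

theorem corollary5p10:
  fixes X :: "'a set" and I :: "'a set set"
  assumes "X \<noteq> {}"
    and "set_ideal X I"
    and "\<not> (\<exists>x. X = {x} \<and> I = Pow X)"
  shows "minimal_set_ideal X I \<longleftrightarrow> maximal_set_ideal X (Ann X I)"
proof -
  have "\<Union>I \<subseteq> X" using assms(2) unfolding set_ideal_def by blast
  then have "X - (X - \<Union>I) = \<Union>I" by blast
  then have "maximal_set_ideal X (Ann X I) \<longleftrightarrow> (\<exists>x. \<Union>I = {x})"
    using maximal_Pow_iff[of "X - \<Union>I" X] by (simp add: Ann_eq_Pow)
  also have "\<dots> \<longleftrightarrow> (\<exists>x. I = Pow {x})"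
    by (simp only: set_ideal_Union_singleton_iff[OF assms(2)])
  also have "\<dots> \<longleftrightarrow> proper_set_ideal X I \<and> (\<exists>x. I = Pow {x})"
    \<comment> \<open>An improper ideal of the form \<open>Pow {x}\<close> forces \<open>X = {x}\<close>, the excluded case.\<close>
    using assms(2,3) unfolding proper_set_ideal_def by (metis Union_Pow_eq)
  also have "\<dots> \<longleftrightarrow> minimal_set_ideal X I"
    by (simp only: minimal_iff_Pow_singleton)
  finally show ?thesis by blast
qed

end
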